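(* Let $g,h$ be real-valued convex functions on the open Euclidean unit ball of $\mathbb{R}^n$ and let $f=g-h$. Extend $g$ and $h$ to functions $\mathbb{R}^n\to\mathbb{R}\cup\{+\infty\}$ by putting $g(x)=h(x)=\infty$ for $\|x\|>1$, and $g(x)=\liminf_{y\to x,\|y\|<1}g(y)$, $h(x)=\liminf_{y\to x,\|y\|<1}h(y)$ for $\|x\|=1$. Let $$A=\{(x,t)\in\mathbb{R}^n\times\mathbb{R}\mid \forall y\in\mathbb{R}^n:\ \langle x,y\rangle+t\leqslant g(y)\},\qquad B=\{(x,t)\in\mathbb{R}^n\times\mathbb{R}\mid \forall y\in\mathbb{R}^n:\ \langle x,y\rangle+t\leqslant h(y)\},$$ and let $V=\{(x,t)\in\mathbb{R}^n\times\mathbb{R}\mid t\leqslant-\|x\|_2\}$. Then the representation $f=g-h$ of the dc-function $f$ is minimal according to Hartman if and only if the pair $(A,B)$ is $H$-minimal in $\mathcal{C}_V^2(\mathbb{R}^{n+1})$.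
   Context: A dc-function is a difference of two convex functions. A representation $f=g-h$ with $g,h$ convex on the open unit ball is minimal according to Hartman if $g,h$ are as small as possible under the conditions $h\geqslant0$ and $h(0)=0$; that is, $h\geqslant 0$ on the open unit ball, $h(0)=0$, and whenever $f=g_1-h_1$ with $g_1,h_1$ convex on the open unit ball, $h_1\geqslant0$, $h_1(0)=0$, $g_1\leqslant g$ and $h_1\leqslant h$ there, then $g_1=g$ and $h_1=h$ there. $\mathcal{C}_V(\mathbb{R}^{n+1})$ is the family of all nonempty closed convex sets $A\subset\mathbb{R}^{n+1}$ whose recession cone $\{x\mid x+A\subset A\}$ equals $V$; $\mathcal{C}_V^2(\mathbb{R}^{n+1})=\mathcal{C}_V(\mathbb{R}^{n+1})\times\mathcal{C}_V(\mathbb{R}^{n+1})$. (The sets $A,B$ of the statement belong to $\mathcal{C}_V(\mathbb{R}^{n+1})$ for the given $V$.) Pairs $(A,B),(C,D)\in\mathcal{C}_V^2(\mathbb{R}^{n+1})$ are equivalent if $A+D=B+C$ (Minkowski sums), and $[A,B]$ denotes the equivalence class. Pairs are ordered by $(A_1,B_1)\prec(A_2,B_2)$ iff $A_1\subset A_2$ and $B_1\subset B_2$. A pair $(A,B)$ is $H$-minimal if it is a minimal element (with respect to $\prec$) of $\{(C,D)\in[A,B]\mid 0\in D \text{ and } x_{n+1}\leqslant0\text{ for all }x\in D\}$. *)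

theory Defs
  imports "HOL-Analysis.Analysis" "HOL-Library.Set_Algebras"
begin

text \<open>
  Functions on the open unit ball are total functions whose values outside \<open>ball 0 1\<close>
  are never inspected.
\<close>

definition dc_representation ::
  "('a::euclidean_space \<Rightarrow> real) \<Rightarrow> ('a \<Rightarrow> real) \<Rightarrow> ('a \<Rightarrow> real) \<Rightarrow> bool" where
  "dc_representation f g h \<longleftrightarrow>
     convex_on (ball 0 1) g \<and> convex_on (ball 0 1) h \<and> (\<forall>x\<in>ball 0 1. f x = g x - h x)"

definition hartman_minimal ::
  "('a::euclidean_space \<Rightarrow> real) \<Rightarrow> ('a \<Rightarrow> real) \<Rightarrow> ('a \<Rightarrow> real) \<Rightarrow> bool" where
  "hartman_minimal f g h \<longleftrightarrow>
     dc_representation f g h \<and> (\<forall>x\<in>ball 0 1. 0 \<le> h x) \<and> h 0 = 0 \<and>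
     (\<forall>g1 h1. dc_representation f g1 h1 \<and> (\<forall>x\<in>ball 0 1. 0 \<le> h1 x) \<and> h1 0 = 0 \<and>
        (\<forall>x\<in>ball 0 1. g1 x \<le> g x) \<and> (\<forall>x\<in>ball 0 1. h1 x \<le> h x)
        \<longrightarrow> (\<forall>x\<in>ball 0 1. g1 x = g x) \<and> (\<forall>x\<in>ball 0 1. h1 x = h x))"

definition ball_extension :: "('a::euclidean_space \<Rightarrow> real) \<Rightarrow> 'a \<Rightarrow> ereal" where
  "ball_extension g x =
     (if norm x < 1 then ereal (g x)
      else if norm x = 1 then Liminf (at x within ball 0 1) (\<lambda>y. ereal (g y))
      else \<infinity>)"

definition recession_cone :: "'a::real_vector set \<Rightarrow> 'a set" where
  "recession_cone A = {x. (+) x ` A \<subseteq> A}"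

definition closed_convex_rec :: "'a::euclidean_space set \<Rightarrow> 'a set set" where
  "closed_convex_rec V = {A. A \<noteq> {} \<and> closed A \<and> convex A \<and> recession_cone A = V}"

text \<open>
  The equivalence class of a pair of members of \<open>closed_convex_rec V\<close>; the sums of sets
  are Minkowski sums, without closure.
\<close>

definition pair_class ::
  "'a::euclidean_space set \<Rightarrow> 'a set \<times> 'a set \<Rightarrow> ('a set \<times> 'a set) set" where
  "pair_class V P =
     {Q \<in> closed_convex_rec V \<times> closed_convex_rec V. fst P + snd Q = snd P + fst Q}"

definition pair_le :: "'a set \<times> 'a set \<Rightarrow> 'a set \<times> 'a set \<Rightarrow> bool" where
  "pair_le P Q \<longleftrightarrow> fst P \<subseteq> fst Q \<and> snd P \<subseteq> snd Q"

definition minimal_element :: "('b \<Rightarrow> 'b \<Rightarrow> bool) \<Rightarrow> 'b set \<Rightarrow> 'b \<Rightarrow> bool" where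
  "minimal_element le S m \<longleftrightarrow> m \<in> S \<and> (\<forall>q\<in>S. le q m \<longrightarrow> q = m)"

text \<open>
  \<open>\<real>\<^sup>n\<^sup>+\<^sup>1\<close> is represented as \<open>'a \<times> real\<close>, so that the last coordinate is \<open>snd\<close>.
  Being an element of the set below already forces both components of \<open>P\<close> to lie in
  \<open>closed_convex_rec V\<close>.
\<close>

definition H_minimal ::
  "('a::euclidean_space \<times> real) set \<Rightarrow> ('a \<times> real) set \<times> ('a \<times> real) set \<Rightarrow> bool" where
  "H_minimal V P \<longleftrightarrow>
     minimal_element pair_le
       {(C, D) \<in> pair_class V P. 0 \<in> D \<and> (\<forall>x\<in>D. snd x \<le> 0)} P"

end

theory Submission imports Defs begin

text \<open>
  The set \<open>A\<close> attached to a convex function \<open>g\<close> on the open unit ball is the set of affine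
  functions \<open>y \<mapsto> \<langle>x, y\<rangle> + t\<close> lying below \<open>g\<close>.  The extension of \<open>g\<close> to the sphere by lower limits
  and to the exterior by \<open>\<infinity>\<close> adds no constraint, because an affine function is continuous
  (\<open>minorants_of_ball_extension\<close>); so everything takes place on the open ball.

  The proof is the duality between convex functions and closed convex sets.  A convex function on
  an open set is the pointwise maximum of its affine minorants (\<open>ex_supporting_minorant\<close>), so \<open>g\<close>
  can be recovered from \<open>A\<close>.  Conversely, evaluation at \<open>y\<close> is the linear functional given by
  \<open>(y, 1)\<close>, and the cone \<open>V\<close> is exactly the set of vectors on which all these functionals,
  \<open>\<parallel>y\<parallel> < 1\<close>, are nonpositive.  They are even negative on \<open>V - {0}\<close>, which makes them bounded above on
  every closed convex set with recession cone \<open>V\<close> (\<open>bdd_above_support\<close>); and every separating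
  functional of such a set is, up to a small perturbation and scaling, one of them
  (\<open>affine_minorants_support_fun\<close>).  Hence \<open>g \<mapsto> A\<close> is an order isomorphism from the convex functions
  on the ball onto the closed convex sets with recession cone \<open>V\<close>.

  It also turns sums of functions into Minkowski sums (\<open>affine_minorants_plus\<close>).  The point here is
  that the Minkowski sum is already closed: two summands cannot escape to infinity while their
  sum stays bounded, since \<open>V\<close> contains no line.  Therefore equivalence of pairs,
  \<open>A + D = B + C\<close>, means that the two differences of convex functions agree.  Finally \<open>0 \<in> B\<close> says
  \<open>h \<ge> 0\<close>, and \<open>B\<close> lies in the lower half-space iff \<open>h 0 \<le> 0\<close>.  So the isomorphism carries
  Hartman's admissible representations of \<open>f\<close>, with their order, to the admissible pairs in
  \<open>[A, B]\<close>, with theirs, and the two notions of minimality coincide.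
\<close>

section \<open>Affine minorants and supporting values\<close>

text \<open>
  The pair \<open>p = (x, t)\<close> stands for the affine function \<open>y \<mapsto> \<langle>x, y\<rangle> + t\<close>, whose value at \<open>y\<close> is written
  as the inner product \<open>p \<bullet> (y, 1)\<close> so that its linearity in \<open>p\<close> is visible.
\<close>

definition affine_minorants :: "('a::euclidean_space \<Rightarrow> real) \<Rightarrow> ('a \<times> real) set" where
  "affine_minorants g = {p. \<forall>y\<in>ball 0 1. p \<bullet> (y, 1) \<le> g y}"

text \<open>
  The usual support function of \<open>C\<close>, restricted to directions normalised to have last
  coordinate 1.  The supremum is meaningful only where it is finite.
\<close>

definition support_fun :: "('a::euclidean_space \<times> real) set \<Rightarrow> 'a \<Rightarrow> real" where
  "support_fun C y = (SUP p\<in>C. p \<bullet> (y, 1))"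

definition down_cone :: "('a::euclidean_space \<times> real) set" where
  "down_cone = {(x, t). t \<le> - norm x}"

lemma affine_minorants_cong:
  assumes "\<And>y. y \<in> ball 0 1 \<Longrightarrow> g y = h y"
  shows "affine_minorants g = affine_minorants h"
  using assms by (auto simp: affine_minorants_def)

text \<open>
  At a boundary point the lower limit of \<open>g\<close> dominates the lower limit of any minorant, which by
  continuity is the value of that minorant.
\<close>

lemma minorants_of_ball_extension:
  "{(x, t). \<forall>y. ereal (x \<bullet> y + t) \<le> ball_extension g y} = affine_minorants g"
proof (intro set_eqI iffI)
  fix p assume "p \<in> {(x, t). \<forall>y. ereal (x \<bullet> y + t) \<le> ball_extension g y}"
  then have le: "ereal (fst p \<bullet> y + snd p) \<le> ball_extension g y" for y
    by auto
  have "p \<bullet> (y, 1) \<le> g y" if "y \<in> ball 0 1" for y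
    using le[of y] that by (simp add: ball_extension_def inner_prod_def)
  then show "p \<in> affine_minorants g"
    by (simp add: affine_minorants_def)
next
  fix p assume p: "p \<in> affine_minorants g"
  have "ereal (fst p \<bullet> y + snd p) \<le> ball_extension g y" for y
  proof -
    consider "norm y < 1" | "norm y = 1" | "norm y > 1" by linarith
    then show ?thesis
    proof cases
      case 1
      then show ?thesis
        using p by (simp add: ball_extension_def affine_minorants_def inner_prod_def)
    next
      case 2
      have nontriv: "at y within ball 0 1 \<noteq> bot"
        using 2 by (simp add: trivial_limit_within islimpt_ball)
      have "((\<lambda>z. ereal (fst p \<bullet> z + snd p)) \<longlongrightarrow> ereal (fst p \<bullet> y + snd p)) (at y within ball 0 1)"
        by (intro tendsto_intros)
      then have "ereal (fst p \<bullet> y + snd p) = Liminf (at y within ball 0 1) (\<lambda>z. ereal (fst p \<bullet> z + snd p))"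
        using lim_imp_Liminf[OF nontriv] by metis
      also have "\<dots> \<le> Liminf (at y within ball 0 1) (\<lambda>z. ereal (g z))"
        using p by (intro Liminf_mono)
          (auto simp: eventually_at_filter affine_minorants_def inner_prod_def)
      finally show ?thesis
        using 2 by (simp add: ball_extension_def)
    next
      case 3
      then show ?thesis by (simp add: ball_extension_def)
    qed
  qed
  then show "p \<in> {(x, t). \<forall>y. ereal (x \<bullet> y + t) \<le> ball_extension g y}"
    by (auto simp: case_prod_beta)
qed

text \<open>
  Existence of subgradients.  The epigraph of \<open>g\<close> is separated from the open vertical ray below
  the point \<open>(y0, g y0)\<close>; the separating hyperplane is the graph of the desired minorant, once it
  is known not to be vertical, which holds because \<open>y0\<close> is an interior point.
\<close>

lemma ex_supporting_minorant:
  fixes g :: "'a::euclidean_space \<Rightarrow> real"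
  assumes g: "convex_on (ball 0 1) g" and y0: "y0 \<in> ball 0 1"
  obtains p where "p \<in> affine_minorants g" "p \<bullet> (y0, 1) = g y0"
proof -
  let ?S = "{y0} \<times> {..<g y0}" and ?T = "epigraph (ball 0 1) g"
  have "convex ?S" "convex ?T"
    using g by (auto intro: convex_Times simp: convex_epigraph)
  moreover have "?S \<noteq> {}" "?T \<noteq> {}" "?S \<inter> ?T = {}"
    using y0 by (auto simp: epigraph_def intro!: exI[of _ "(y0, g y0)"])
  ultimately obtain a b where "a \<noteq> 0"
    and S: "\<forall>x\<in>?S. a \<bullet> x \<le> b" and T: "\<forall>x\<in>?T. a \<bullet> x \<ge> b"
    using separating_hyperplane_sets by metis
  obtain v c where a: "a = (v, c)" by (cases a)
  have S': "v \<bullet> y0 + c * s \<le> b" if "s < g y0" for s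
    using S that by (auto simp: a)
  have T': "v \<bullet> y + c * g y \<ge> b" if "y \<in> ball 0 1" for y
    using T that by (auto simp: a epigraph_def)
  have "c \<ge> 0"
    using S'[of "g y0 - 1"] T'[OF y0] by (simp add: algebra_simps)
  have at_y0: "v \<bullet> y0 + c * g y0 \<le> b"
  proof (rule field_le_epsilon)
    fix e :: real assume "e > 0"
    \<comment> \<open>Dividing by \<open>c + 1\<close> instead of \<open>c\<close> also covers the vertical case \<open>c = 0\<close>.\<close>
    have "v \<bullet> y0 + c * (g y0 - e / (c + 1)) \<le> b"
      using \<open>e > 0\<close> \<open>c \<ge> 0\<close> by (intro S') simp
    moreover have "c * (e / (c + 1)) \<le> e"
      using \<open>e > 0\<close> \<open>c \<ge> 0\<close> by (simp add: field_simps)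
    ultimately show "v \<bullet> y0 + c * g y0 \<le> b + e"
      by (simp add: algebra_simps)
  qed
  have main: "v \<bullet> y0 + c * g y0 \<le> v \<bullet> y + c * g y" if "y \<in> ball 0 1" for y
    using T'[OF that] at_y0 by linarith
  have "c \<noteq> 0"
  proof
    assume "c = 0"
    then have "v \<noteq> 0" using \<open>a \<noteq> 0\<close> by (auto simp: a zero_prod_def)
    obtain e where e: "e > 0" "ball y0 e \<subseteq> ball 0 1"
      using y0 open_ball open_contains_ball by metis
    \<comment> \<open>Moving inside the ball against the horizontal normal violates \<open>main\<close>.\<close>
    define y where "y = y0 - (e / (2 * norm v)) *\<^sub>R v"
    have "y \<in> ball y0 e"
      using e(1) \<open>v \<noteq> 0\<close> by (simp add: y_def dist_norm)
    then have "v \<bullet> y0 \<le> v \<bullet> y"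
      using main[of y] e(2) \<open>c = 0\<close> by auto
    then have "(e / (2 * norm v)) * (v \<bullet> v) \<le> 0"
      by (simp add: y_def inner_diff_right)
    moreover have "(e / (2 * norm v)) * (v \<bullet> v) > 0"
      using e(1) \<open>v \<noteq> 0\<close> by (intro mult_pos_pos) auto
    ultimately show False by linarith
  qed
  then have "c > 0" using \<open>c \<ge> 0\<close> by simp
  define p where "p = (- (v /\<^sub>R c), g y0 + (v \<bullet> y0) / c)"
  have val: "p \<bullet> (y, 1) = g y0 + (v \<bullet> y0 - v \<bullet> y) / c" for y
    by (simp add: p_def inner_prod_def divide_inverse algebra_simps)
  show thesis
  proof
    show "p \<in> affine_minorants g"
      unfolding affine_minorants_def
    proof (intro CollectI ballI)
      fix y :: 'a assume "y \<in> ball 0 1"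
      then have "(v \<bullet> y0 - v \<bullet> y) / c \<le> g y - g y0"
        using main[of y] \<open>c > 0\<close> by (simp add: field_simps)
      then show "p \<bullet> (y, 1) \<le> g y" by (simp add: val)
    qed
    show "p \<bullet> (y0, 1) = g y0" by (simp add: val)
  qed
qed

lemma affine_minorants_subset_iff:
  assumes "convex_on (ball 0 1) g"
  shows "affine_minorants g \<subseteq> affine_minorants h \<longleftrightarrow> (\<forall>y\<in>ball 0 1. g y \<le> h y)"
proof
  assume sub: "affine_minorants g \<subseteq> affine_minorants h"
  show "\<forall>y\<in>ball 0 1. g y \<le> h y"
  proof
    fix y :: 'a assume y: "y \<in> ball 0 1"
    obtain p where "p \<in> affine_minorants g" "p \<bullet> (y, 1) = g y"
      using ex_supporting_minorant[OF assms y] .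
    then show "g y \<le> h y"
      using sub y by (force simp: affine_minorants_def)
  qed
qed (force simp: affine_minorants_def)

section \<open>Recession cones\<close>

lemma inner_sgn_eq_norm:
  fixes x :: "'a::real_inner"
  shows "x \<bullet> sgn x = norm x"
  by (cases "x = 0") (simp_all add: sgn_div_norm dot_square_norm power2_eq_square)

text \<open>
  The cone is polar to the directions \<open>(y, 1)\<close> with \<open>y\<close> in the open ball: the supremum of
  \<open>\<langle>x, y\<rangle>\<close> over the ball is \<open>\<parallel>x\<parallel>\<close>.
\<close>

lemma mem_down_cone_iff:
  "v \<in> down_cone \<longleftrightarrow> (\<forall>y\<in>ball 0 1. v \<bullet> (y, 1) \<le> 0)"
proof
  assume v: "v \<in> down_cone"
  show "\<forall>y\<in>ball 0 1. v \<bullet> (y, 1) \<le> 0"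
  proof
    fix y :: 'a assume "y \<in> ball 0 1"
    then have "norm (fst v) * norm y \<le> norm (fst v)"
      by (simp add: mult_left_le)
    then show "v \<bullet> (y, 1) \<le> 0"
      using norm_cauchy_schwarz[of "fst v" y] v by (auto simp: down_cone_def inner_prod_def)
  qed
next
  assume le: "\<forall>y\<in>ball 0 1. v \<bullet> (y, 1) \<le> 0"
  have "snd v + norm (fst v) \<le> 0"
  proof (rule field_le_epsilon)
    fix e :: real assume "e > 0"
    \<comment> \<open>The maximising direction has norm 1 and is shrunk into the open ball; the factor is
      chosen so that the loss \<open>(1 - r) * norm (fst v)\<close> is exactly \<open>r * e\<close>.\<close>
    define r where "r = norm (fst v) / (norm (fst v) + e)"
    have r: "0 \<le> r" "r < 1"
      using \<open>e > 0\<close> by (auto simp: r_def divide_simps add_nonneg_pos)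
    have "r *\<^sub>R sgn (fst v) \<in> ball 0 1"
      using r by (simp add: norm_sgn)
    with le have "v \<bullet> (r *\<^sub>R sgn (fst v), 1) \<le> 0" by blast
    then have "r * norm (fst v) + snd v \<le> 0"
      by (simp add: inner_prod_def inner_sgn_eq_norm)
    moreover have "norm (fst v) - r * norm (fst v) \<le> e"
    proof -
      have "norm (fst v) + e \<noteq> 0"
        using \<open>e > 0\<close> norm_ge_zero[of "fst v"] by linarith
      then have "norm (fst v) - r * norm (fst v) = r * e"
        by (simp add: r_def field_simps)
      also have "\<dots> \<le> e" using r \<open>e > 0\<close> by simp
      finally show ?thesis .
    qed
    ultimately show "snd v + norm (fst v) \<le> 0 + e" by linarith
  qed
  then show "v \<in> down_cone" by (auto simp: down_cone_def case_prod_beta)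
qed

text \<open>
  Strictness on the open ball is what excludes recession directions along which evaluation at
  \<open>y\<close> stays constant; boundedness of support functions rests on it.
\<close>

lemma inner_neg_of_down_cone:
  assumes "v \<in> down_cone" "v \<noteq> 0" "y \<in> ball 0 1"
  shows "v \<bullet> (y, 1) < 0"
proof (cases "fst v = 0")
  case True
  then have "snd v < 0"
    using assms by (auto simp: down_cone_def prod_eq_iff)
  then show ?thesis using True by (simp add: inner_prod_def)
next
  case False
  then have "norm (fst v) * norm y < norm (fst v)"
    using assms(3) by simp
  then show ?thesis
    using norm_cauchy_schwarz[of "fst v" y] assms(1) by (auto simp: down_cone_def inner_prod_def)
qed

text \<open>
  A recession direction can be added any number of times, so a functional that is bounded above
  on the set cannot be positive on it.
\<close>

lemma recession_cone_inner_le_0: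
  fixes C :: "'a::real_inner set"
  assumes v: "v \<in> recession_cone C" and c: "c \<in> C"
    and bound: "\<And>p. p \<in> C \<Longrightarrow> p \<bullet> w \<le> M"
  shows "v \<bullet> w \<le> 0"
proof (rule ccontr)
  assume "\<not> v \<bullet> w \<le> 0"
  then have pos: "v \<bullet> w > 0" by simp
  have "c + real n *\<^sub>R v \<in> C" for n
  proof (induction n)
    case (Suc n)
    then have "v + (c + real n *\<^sub>R v) \<in> C"
      using v by (auto simp: recession_cone_def)
    then show ?case by (simp add: algebra_simps)
  qed (use c in simp)
  from bound[OF this] have le: "c \<bullet> w + real n * (v \<bullet> w) \<le> M" for n
    by (simp add: inner_add_left)
  obtain n where "real n * (v \<bullet> w) > M - c \<bullet> w"
    using pos reals_Archimedean3 by blast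
  with le[of n] show False by simp
qed

text \<open>
  Finite bounds in the directions \<open>(y, 1)\<close> already keep the recession cone inside the polar of
  those directions, so it remains to know that \<open>C\<close> absorbs the cone.
\<close>

lemma closed_convex_recI:
  fixes C :: "('a::euclidean_space \<times> real) set"
  assumes "closed C" "convex C" "C \<noteq> {}"
    and "\<And>v c. v \<in> down_cone \<Longrightarrow> c \<in> C \<Longrightarrow> v + c \<in> C"
    and "\<And>y p. y \<in> ball 0 1 \<Longrightarrow> p \<in> C \<Longrightarrow> p \<bullet> (y, 1) \<le> g y"
  shows "C \<in> closed_convex_rec down_cone"
proof -
  obtain c where "c \<in> C" using assms(3) by auto
  then have "recession_cone C \<subseteq> down_cone"
    unfolding subset_eq mem_down_cone_iff
    by (metis recession_cone_inner_le_0 assms(5))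
  moreover have "down_cone \<subseteq> recession_cone C"
    using assms(4) by (auto simp: recession_cone_def)
  ultimately show ?thesis
    using assms(1-3) by (simp add: closed_convex_rec_def)
qed

lemma affine_minorants_closed_convex_rec:
  fixes g :: "'a::euclidean_space \<Rightarrow> real"
  assumes "convex_on (ball 0 1) g"
  shows "affine_minorants g \<in> closed_convex_rec down_cone"
proof (rule closed_convex_recI)
  have eq: "affine_minorants g = (\<Inter>y\<in>ball 0 1. {p. (y, 1) \<bullet> p \<le> g y})"
    by (auto simp: affine_minorants_def inner_commute)
  show "closed (affine_minorants g)"
    unfolding eq by (intro closed_INT ballI closed_halfspace_le)
  show "convex (affine_minorants g)"
    unfolding eq by (intro convex_INT convex_halfspace_le)
  show "affine_minorants g \<noteq> {}"
    using ex_supporting_minorant[OF assms, of 0] by force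
  show "v + c \<in> affine_minorants g" if "v \<in> down_cone" "c \<in> affine_minorants g" for v c
    unfolding affine_minorants_def
  proof (intro CollectI ballI)
    fix y :: 'a assume "y \<in> ball 0 1"
    then have "v \<bullet> (y, 1) \<le> 0" "c \<bullet> (y, 1) \<le> g y"
      using that by (simp_all only: mem_down_cone_iff affine_minorants_def mem_Collect_eq)
    then show "(v + c) \<bullet> (y, 1) \<le> g y"
      by (simp only: inner_add_left)
  qed
qed (auto simp: affine_minorants_def)

section \<open>Support functions\<close>

text \<open>
  Limits of vanishing multiples of chords are recession directions: starting from any point \<open>p\<close> of
  \<open>C\<close>, moving the fraction \<open>l n\<close> of the way towards \<open>c n\<close> stays in \<open>C\<close> and tends to \<open>p + d\<close>.
\<close>

lemma recession_direction_limit: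
  fixes C :: "'a::euclidean_space set"
  assumes C: "closed C" "convex C" and c: "\<And>n. c n \<in> C"
    and l: "\<And>n. 0 \<le> l n" "l \<longlonglongrightarrow> 0"
    and lim: "(\<lambda>n. l n *\<^sub>R (c n - c0)) \<longlonglongrightarrow> d"
  shows "d \<in> recession_cone C"
proof -
  have "d + p \<in> C" if p: "p \<in> C" for p
  proof (rule Lim_in_closed_set[OF C(1)])
    have "(\<lambda>n. l n *\<^sub>R (c n - c0) + p + l n *\<^sub>R (c0 - p)) \<longlonglongrightarrow> d + p + 0 *\<^sub>R (c0 - p)"
      by (intro tendsto_intros lim l(2))
    moreover have "l n *\<^sub>R (c n - c0) + p + l n *\<^sub>R (c0 - p) = (1 - l n) *\<^sub>R p + l n *\<^sub>R c n" for n
      by (simp add: algebra_simps)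
    ultimately show "(\<lambda>n. (1 - l n) *\<^sub>R p + l n *\<^sub>R c n) \<longlonglongrightarrow> d + p"
      by simp
    have "\<forall>\<^sub>F n in sequentially. l n < 1"
      using l(2) by (rule order_tendstoD) simp
    then show "\<forall>\<^sub>F n in sequentially. (1 - l n) *\<^sub>R p + l n *\<^sub>R c n \<in> C"
    proof eventually_elim
      case (elim n)
      then show ?case
        using convexD[OF C(2) p c, of "1 - l n" "l n" n] l(1)[of n] by simp
    qed
  qed simp
  then show ?thesis by (auto simp: recession_cone_def)
qed

text \<open>
  If evaluation at \<open>y\<close> were unbounded on \<open>C\<close>, points of \<open>C\<close> with values tending to infinity would
  accumulate in a unit recession direction on which the evaluation is nonnegative, against
  \<open>inner_neg_of_down_cone\<close>.
\<close>

lemma bdd_above_support: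
  fixes C :: "('a::euclidean_space \<times> real) set"
  assumes C: "C \<in> closed_convex_rec down_cone" and y: "y \<in> ball 0 1"
  shows "bdd_above ((\<lambda>p. p \<bullet> (y, 1)) ` C)"
proof (rule ccontr)
  assume unbdd: "\<not> bdd_above ((\<lambda>p. p \<bullet> (y, 1)) ` C)"
  obtain c0 where c0: "c0 \<in> C"
    using C by (auto simp: closed_convex_rec_def)
  let ?w = "(y, 1::real)"
  \<comment> \<open>The multiple of \<open>norm ?w\<close> turns growth of the values into growth of the distances from \<open>c0\<close>,
    by the Cauchy-Schwarz inequality.\<close>
  have "\<exists>c\<in>C. c \<bullet> ?w > c0 \<bullet> ?w + real (Suc n) * norm ?w" for n
    using unbdd unfolding bdd_above_def by (auto simp: not_le)
  then obtain c where c: "\<And>n. c n \<in> C"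
    "\<And>n. c n \<bullet> ?w > c0 \<bullet> ?w + real (Suc n) * norm ?w"
    by metis
  have w: "norm ?w > 0" by (simp add: zero_prod_def)
  have far: "norm (c n - c0) > real (Suc n)" for n
  proof -
    have "real (Suc n) * norm ?w < (c n - c0) \<bullet> ?w"
      using c(2)[of n] by (simp add: inner_diff_left)
    also have "\<dots> \<le> norm (c n - c0) * norm ?w" by (rule norm_cauchy_schwarz)
    finally show ?thesis using w by (simp only: mult_less_cancel_right_pos)
  qed
  define l where "l n = inverse (norm (c n - c0))" for n
  have l0: "0 \<le> l n" for n by (simp add: l_def)
  have l_le: "l n \<le> inverse (real (Suc n))" for n
    unfolding l_def using far[of n] by (intro le_imp_inverse_le) auto
  have l_lim: "l \<longlonglongrightarrow> 0"
    by (rule tendsto_sandwich[OF _ _ tendsto_const LIMSEQ_inverse_real_of_nat])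
       (use l0 l_le in auto)
  define e where "e n = l n *\<^sub>R (c n - c0)" for n
  have "e n \<in> sphere 0 1" for n
  proof -
    have "c n \<noteq> c0" using far[of n] by auto
    then show ?thesis by (simp add: e_def l_def)
  qed
  then obtain d r where d: "d \<in> sphere 0 1" and r: "strict_mono (r :: nat \<Rightarrow> nat)" "(e \<circ> r) \<longlonglongrightarrow> d"
    using compact_sphere[of "0 :: 'a \<times> real" 1] unfolding compact_def by metis
  have "d \<in> recession_cone C"
  proof (rule recession_direction_limit)
    show "(\<lambda>n. (l \<circ> r) n *\<^sub>R ((c \<circ> r) n - c0)) \<longlonglongrightarrow> d"
      using r(2) by (simp add: e_def o_def)
    show "(l \<circ> r) \<longlonglongrightarrow> 0" by (rule LIMSEQ_subseq_LIMSEQ[OF l_lim r(1)])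
  qed (use C c l0 in \<open>auto simp: closed_convex_rec_def\<close>)
  then have "d \<in> down_cone"
    using C by (simp add: closed_convex_rec_def)
  moreover have "d \<noteq> 0" using d by auto
  ultimately have "d \<bullet> ?w < 0"
    using y by (rule inner_neg_of_down_cone)
  moreover have "0 \<le> d \<bullet> ?w"
  proof (rule LIMSEQ_le_const)
    show "(\<lambda>n. (e \<circ> r) n \<bullet> ?w) \<longlonglongrightarrow> d \<bullet> ?w" 
      by (rule tendsto_inner[OF r(2) tendsto_const])
    have "0 \<le> e n \<bullet> ?w" for n
    proof -
      have "0 \<le> (c n - c0) \<bullet> ?w"
      proof -
        have "0 \<le> real (Suc n) * norm ?w"
          by (intro mult_nonneg_nonneg) auto
        also have "\<dots> \<le> (c n - c0) \<bullet> ?w"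
          using c(2)[of n] by (simp only: inner_diff_left)
        finally show ?thesis .
      qed
      then show ?thesis using l0 by (simp add: e_def)
    qed
    then show "\<exists>N. \<forall>n\<ge>N. 0 \<le> (e \<circ> r) n \<bullet> ?w" by simp
  qed
  ultimately show False by simp
qed

lemma le_support_fun:
  assumes "C \<in> closed_convex_rec down_cone" "y \<in> ball 0 1" "p \<in> C"
  shows "p \<bullet> (y, 1) \<le> support_fun C y"
  unfolding support_fun_def by (rule cSUP_upper[OF assms(3) bdd_above_support[OF assms(1,2)]])

lemma support_fun_le:
  assumes "C \<in> closed_convex_rec down_cone" "\<And>p. p \<in> C \<Longrightarrow> p \<bullet> (y, 1) \<le> M"
  shows "support_fun C y \<le> M"
  unfolding support_fun_def using assms by (intro cSUP_least) (auto simp: closed_convex_rec_def)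

lemma convex_on_support_fun:
  fixes C :: "('a::euclidean_space \<times> real) set"
  assumes C: "C \<in> closed_convex_rec down_cone"
  shows "convex_on (ball 0 1) (support_fun C)"
proof (rule convex_onI)
  fix t :: real and x y :: 'a
  assume t: "0 < t" "t < 1" and xy: "x \<in> ball 0 1" "y \<in> ball 0 1"
  show "support_fun C ((1 - t) *\<^sub>R x + t *\<^sub>R y) \<le> (1 - t) * support_fun C x + t * support_fun C y"
  proof (rule support_fun_le[OF C])
    fix p assume "p \<in> C"
    have "p \<bullet> ((1 - t) *\<^sub>R x + t *\<^sub>R y, 1) = (1 - t) * (p \<bullet> (x, 1)) + t * (p \<bullet> (y, 1))"
      by (simp add: inner_prod_def algebra_simps)
    also have "\<dots> \<le> (1 - t) * support_fun C x + t * support_fun C y"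
      using t xy le_support_fun[OF C _ \<open>p \<in> C\<close>] by (intro add_mono mult_left_mono) auto
    finally show "p \<bullet> ((1 - t) *\<^sub>R x + t *\<^sub>R y, 1) \<le> (1 - t) * support_fun C x + t * support_fun C y" .
  qed
qed (rule convex_ball)

text \<open>
  A point outside \<open>C\<close> is strictly separated from \<open>C\<close> by some functional \<open>(y, r)\<close>.  Boundedness on
  \<open>C\<close> makes it nonpositive on the recession cone, that is, \<open>\<parallel>y\<parallel> \<le> r\<close>.  In the boundary case
  \<open>\<parallel>y\<parallel> = r\<close> it does not come from a point of the open ball; adding a small multiple of \<open>(0, 1)\<close>,
  which is itself bounded on \<open>C\<close>, repairs this and preserves the strict separation.
\<close>

lemma affine_minorants_support_fun:
  fixes C :: "('a::euclidean_space \<times> real) set"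
  assumes C: "C \<in> closed_convex_rec down_cone"
  shows "affine_minorants (support_fun C) = C"
proof
  show "C \<subseteq> affine_minorants (support_fun C)"
    using le_support_fun[OF C] by (auto simp: affine_minorants_def)
  show "affine_minorants (support_fun C) \<subseteq> C"
  proof
    fix q assume q: "q \<in> affine_minorants (support_fun C)"
    show "q \<in> C"
    proof (rule ccontr)
      assume "q \<notin> C"
      with C obtain a b where "a \<bullet> q < b" "\<forall>x\<in>C. a \<bullet> x > b"
        using separating_hyperplane_closed_point[of C q] by (auto simp: closed_convex_rec_def)
      then have sep: "q \<bullet> (- a) > - b" "\<And>p. p \<in> C \<Longrightarrow> p \<bullet> (- a) \<le> - b"
        by (auto simp: inner_commute less_imp_le)
      define M where "M = support_fun C 0"
      have M: "p \<bullet> (0, 1) \<le> M" if "p \<in> C" for p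
        using le_support_fun[OF C _ that, of 0] by (simp add: M_def)
      obtain c where "c \<in> C" using C by (auto simp: closed_convex_rec_def)
      obtain y r where yr: "- a = (y, r)" by (cases "- a")
      have polar: "v \<bullet> (- a) \<le> 0" if "v \<in> down_cone" for v
        using recession_cone_inner_le_0[OF _ \<open>c \<in> C\<close> sep(2)] that C
        by (auto simp: closed_convex_rec_def)
      have r: "norm y \<le> r"
      proof (cases "y = 0")
        case True
        then show ?thesis using polar[of "(0, -1)"] by (simp add: yr down_cone_def)
      next
        case False
        have "y \<bullet> y \<le> norm y * r"
          using polar[of "(y, - norm y)"] by (simp add: yr down_cone_def)
        then show ?thesis using False by (simp add: dot_square_norm power2_eq_square)
      qed
      define gap where "gap = q \<bullet> (- a) + b"
      have "gap > 0" using sep(1) by (simp add: gap_def)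
      \<comment> \<open>\<open>M\<close> bounds \<open>(0, 1)\<close> on \<open>C\<close>, so a perturbation by \<open>e\<close> costs at most
        \<open>e * (M - q \<bullet> (0, 1))\<close>, which must remain below the separation gap.\<close>
      define e where "e = gap / (\<bar>M - q \<bullet> (0, 1)\<bar> + 1)"
      have "e > 0" using \<open>gap > 0\<close> by (simp add: e_def)
      have "e * \<bar>M - q \<bullet> (0, 1)\<bar> < gap"
        using \<open>gap > 0\<close> by (simp add: e_def field_simps)
      moreover have "e * (M - q \<bullet> (0, 1)) \<le> e * \<bar>M - q \<bullet> (0, 1)\<bar>"
        using \<open>e > 0\<close> by (intro mult_left_mono) auto
      ultimately have e: "e * (M - q \<bullet> (0, 1)) < gap" by linarith
      define s where "s = r + e"
      have s: "s > 0" "norm y < s" using r \<open>e > 0\<close> norm_ge_zero[of y] unfolding s_def by linarith+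
      have split: "p \<bullet> (y /\<^sub>R s, 1) = (p \<bullet> (- a) + e * (p \<bullet> (0, 1))) / s" for p
        using s(1) by (simp add: yr s_def inner_prod_def field_simps)
      have "y /\<^sub>R s \<in> ball 0 1" using s by (simp add: field_simps)
      moreover have "support_fun C (y /\<^sub>R s) \<le> (- b + e * M) / s"
      proof (rule support_fun_le[OF C])
        fix p assume "p \<in> C"
        then show "p \<bullet> (y /\<^sub>R s, 1) \<le> (- b + e * M) / s"
          unfolding split using s(1) sep(2) M \<open>e > 0\<close>
          by (intro divide_right_mono add_mono mult_left_mono) auto
      qed
      ultimately have "q \<bullet> (y /\<^sub>R s, 1) \<le> (- b + e * M) / s"
        using q unfolding affine_minorants_def by (blast intro: order.trans)
      then have "q \<bullet> (- a) + e * (q \<bullet> (0, 1)) \<le> - b + e * M"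
        unfolding split using s(1) by (simp add: divide_le_cancel)
      then show False using e by (simp add: gap_def algebra_simps)
    qed
  qed
qed

section \<open>Minkowski sums\<close>

text \<open>
  An affine function is controlled by its values on a ball: the value at the centre is the
  constant term, and the value in the direction of the linear part gives the norm of the latter.
\<close>

lemma norm_le_of_values_on_half_ball:
  fixes p :: "'a::euclidean_space \<times> real"
  assumes "\<And>y. norm y \<le> 1/2 \<Longrightarrow> \<bar>p \<bullet> (y, 1)\<bar> \<le> L"
  shows "norm p \<le> 5 * L"
proof -
  have s: "\<bar>snd p\<bar> \<le> L"
    using assms[of 0] by (simp add: inner_prod_def)
  have "\<bar>p \<bullet> ((1/2) *\<^sub>R sgn (fst p), 1)\<bar> \<le> L"
    by (rule assms) (simp add: norm_sgn)
  moreover have "p \<bullet> ((1/2) *\<^sub>R sgn (fst p), 1) = norm (fst p) / 2 + snd p"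
    by (simp add: inner_prod_def inner_sgn_eq_norm)
  ultimately have "norm (fst p) \<le> 4 * L" using s by linarith
  then show ?thesis
    using s norm_Pair_le[of "fst p" "snd p"] by simp
qed

text \<open>
  If \<open>a + d\<close> is close to \<open>z\<close>, then \<open>a\<close> is bounded above by \<open>g\<close> and, because \<open>d\<close> lies below \<open>h\<close>, also
  bounded below.  So near \<open>z\<close> only a compact part \<open>K\<close> of the first summand matters, and the sum of a
  compact and a closed set is closed.  The half ball serves as a compact subset of the domain, on
  which \<open>g\<close> and \<open>h\<close> are bounded by continuity.
\<close>

lemma closed_affine_minorants_plus:
  fixes g h :: "'a::euclidean_space \<Rightarrow> real"
  assumes g: "convex_on (ball 0 1) g" and h: "convex_on (ball 0 1) h"
  shows "closed (affine_minorants g + affine_minorants h)"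
proof -
  let ?A = "affine_minorants g" and ?D = "affine_minorants h"
  have half: "cball 0 (1/2) \<subseteq> ball (0::'a) 1" by auto
  have "\<exists>M. \<forall>y\<in>cball 0 (1/2). \<bar>k y\<bar> \<le> M" if "convex_on (ball 0 1) k" for k :: "'a \<Rightarrow> real"
  proof -
    have "continuous_on (cball 0 (1/2)) k"
      using continuous_on_subset[OF convex_on_continuous[OF open_ball that] half] .
    then have "bounded (k ` cball 0 (1/2))"
      by (intro compact_imp_bounded compact_continuous_image) auto
    then show ?thesis by (auto simp: bounded_iff)
  qed
  from this[OF g] this[OF h] obtain Mg Mh
    where Mg: "\<And>y. norm y \<le> 1/2 \<Longrightarrow> \<bar>g y\<bar> \<le> Mg" and Mh: "\<And>y. norm y \<le> 1/2 \<Longrightarrow> \<bar>h y\<bar> \<le> Mh"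
    by (metis mem_cball_0)
  have "z \<in> ?A + ?D" if z: "z \<in> closure (?A + ?D)" for z
  proof -
    define L where "L = (norm z + 1) * 2 + \<bar>Mg\<bar> + \<bar>Mh\<bar>"
    define K where "K = ?A \<inter> cball 0 (5 * L)"
    have closedA: "closed ?A" "closed ?D"
      using affine_minorants_closed_convex_rec g h by (auto simp: closed_convex_rec_def)
    have "compact K"
      unfolding K_def by (intro closed_Int_compact closedA compact_cball)
    then have "closed (K + ?D)"
      using compact_closed_sums[OF _ closedA(2), of K] unfolding set_plus_def
      by (simp add: UNION_eq Bex_def)
    have "ball z 1 \<inter> (?A + ?D) \<subseteq> K + ?D"
    proof
      fix x assume x: "x \<in> ball z 1 \<inter> (?A + ?D)"
      then obtain a d where ad: "x = a + d" "a \<in> ?A" "d \<in> ?D"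
        by (auto elim: set_plus_elim)
      have "norm x \<le> norm z + 1"
        using x norm_triangle_sub[of x z] by (auto simp: dist_norm norm_minus_commute)
      have "\<bar>a \<bullet> (y, 1)\<bar> \<le> L" if y: "norm y \<le> 1/2" for y
      proof -
        have y1: "y \<in> ball 0 1" using y by simp
        have "norm (y, 1::real) \<le> 2"
          using norm_Pair_le[of y "1::real"] y by simp
        then have "norm x * norm (y, 1::real) \<le> (norm z + 1) * 2"
          using \<open>norm x \<le> norm z + 1\<close> by (intro mult_mono) auto
        then have "\<bar>x \<bullet> (y, 1)\<bar> \<le> (norm z + 1) * 2"
          using Cauchy_Schwarz_ineq2[of x "(y, 1)"] by linarith
        moreover have "x \<bullet> (y, 1) = a \<bullet> (y, 1) + d \<bullet> (y, 1)"
          by (simp only: ad(1) inner_add_left)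
        moreover have "a \<bullet> (y, 1) \<le> g y" "d \<bullet> (y, 1) \<le> h y"
          using ad y1 unfolding affine_minorants_def by blast+
        ultimately show ?thesis
          using Mg[OF y] Mh[OF y] norm_ge_zero[of z] unfolding L_def by linarith
      qed
      then have "a \<in> K"
        using norm_le_of_values_on_half_ball[of a L] ad by (simp add: K_def)
      then show "x \<in> K + ?D" using ad by auto
    qed
    then have "closure (ball z 1 \<inter> (?A + ?D)) \<subseteq> K + ?D"
      using \<open>closed (K + ?D)\<close> by (rule closure_minimal)
    moreover have "z \<in> closure (ball z 1 \<inter> (?A + ?D))"
      using open_Int_closure_subset[of "ball z 1" "?A + ?D"] z by auto
    ultimately have "z \<in> K + ?D" by blast
    then show ?thesis by (auto simp: K_def elim!: set_plus_elim)
  qed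
  then show ?thesis
    using closure_subset_eq by blast
qed

text \<open>
  The Minkowski sum is again a closed convex set with the same recession cone, so it is determined
  by its support function, which is \<open>g + h\<close> because the supporting minorants add up.
\<close>

lemma affine_minorants_plus:
  fixes g h :: "'a::euclidean_space \<Rightarrow> real"
  assumes g: "convex_on (ball 0 1) g" and h: "convex_on (ball 0 1) h"
  shows "affine_minorants g + affine_minorants h = affine_minorants (\<lambda>y. g y + h y)"
proof -
  let ?S = "affine_minorants g + affine_minorants h"
  note AD = affine_minorants_closed_convex_rec[OF g] affine_minorants_closed_convex_rec[OF h]
  have le: "p \<bullet> (y, 1) \<le> g y + h y" if "y \<in> ball 0 1" "p \<in> ?S" for y p
    using that by (auto elim!: set_plus_elim simp only: affine_minorants_def mem_Collect_eq inner_add_left intro!: add_mono)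
  have S: "?S \<in> closed_convex_rec down_cone"
  proof (rule closed_convex_recI[OF closed_affine_minorants_plus[OF g h] _ _ _ le])
    show "convex ?S"
      using AD by (intro convex_set_plus) (auto simp: closed_convex_rec_def)
    show "?S \<noteq> {}"
      using AD unfolding closed_convex_rec_def by (blast intro: set_plus_intro)
    show "v + c \<in> ?S" if v: "v \<in> down_cone" and c: "c \<in> ?S" for v c
    proof -
      obtain a d where ad: "c = a + d" "a \<in> affine_minorants g" "d \<in> affine_minorants h"
        using c by (rule set_plus_elim)
      have "v + a \<in> affine_minorants g"
        using v ad(2) AD(1) by (auto simp: closed_convex_rec_def recession_cone_def)
      then have "(v + a) + d \<in> ?S" using ad(3) by (rule set_plus_intro)
      then show ?thesis by (simp add: ad(1) add.assoc)
    qed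
  qed
  have "support_fun ?S y = g y + h y" if y: "y \<in> ball 0 1" for y
  proof (rule antisym)
    show "support_fun ?S y \<le> g y + h y"
      using le[OF y] by (intro support_fun_le[OF S])
    obtain p where p: "p \<in> affine_minorants g" "p \<bullet> (y, 1) = g y"
      using ex_supporting_minorant[OF g y] .
    obtain q where q: "q \<in> affine_minorants h" "q \<bullet> (y, 1) = h y"
      using ex_supporting_minorant[OF h y] .
    have "(p + q) \<bullet> (y, 1) \<le> support_fun ?S y"
      using p q by (intro le_support_fun[OF S y]) auto
    then show "g y + h y \<le> support_fun ?S y"
      using p q by (simp only: inner_add_left)
  qed
  then have "affine_minorants (support_fun ?S) = affine_minorants (\<lambda>y. g y + h y)"
    by (rule affine_minorants_cong)
  then show ?thesis
    by (simp add: affine_minorants_support_fun[OF S])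
qed

section \<open>Hartman minimality\<close>

lemma affine_minorants_eq_iff:
  assumes "convex_on (ball 0 1) g" "convex_on (ball 0 1) h"
  shows "affine_minorants g = affine_minorants h \<longleftrightarrow> (\<forall>y\<in>ball 0 1. g y = h y)"
  using affine_minorants_subset_iff[OF assms(1), of h] affine_minorants_subset_iff[OF assms(2), of g]
  by (auto simp: set_eq_subset order.antisym)

text \<open>
  Equivalence of pairs is equality of the represented differences: \<open>A + D = B + C\<close> translates to
  \<open>g + h1 = h + g1\<close>.
\<close>

lemma affine_minorants_pair_class_iff:
  fixes g h g1 h1 :: "'a::euclidean_space \<Rightarrow> real"
  assumes g: "convex_on (ball 0 1) g" and h: "convex_on (ball 0 1) h"
    and g1: "convex_on (ball 0 1) g1" and h1: "convex_on (ball 0 1) h1"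
  shows "(affine_minorants g1, affine_minorants h1)
           \<in> pair_class down_cone (affine_minorants g, affine_minorants h)
         \<longleftrightarrow> (\<forall>y\<in>ball 0 1. g1 y - h1 y = g y - h y)"
proof -
  have "(affine_minorants g1, affine_minorants h1)
           \<in> pair_class down_cone (affine_minorants g, affine_minorants h)
        \<longleftrightarrow> affine_minorants (\<lambda>y. g y + h1 y) = affine_minorants (\<lambda>y. h y + g1 y)"
    using affine_minorants_closed_convex_rec[OF g1] affine_minorants_closed_convex_rec[OF h1]
    by (simp add: pair_class_def affine_minorants_plus[OF g h1] affine_minorants_plus[OF h g1])
  also have "\<dots> \<longleftrightarrow> (\<forall>y\<in>ball 0 1. g y + h1 y = h y + g1 y)"
    by (intro affine_minorants_eq_iff convex_on_add g h g1 h1)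
  also have "\<dots> \<longleftrightarrow> (\<forall>y\<in>ball 0 1. g1 y - h1 y = g y - h y)"
    by (intro ball_cong refl) linarith
  finally show ?thesis .
qed

lemma zero_mem_affine_minorants_iff:
  "0 \<in> affine_minorants h \<longleftrightarrow> (\<forall>y\<in>ball 0 1. 0 \<le> h y)"
  by (auto simp: affine_minorants_def)

text \<open>
  The largest last coordinate of a minorant is its largest value at the centre, which is \<open>h 0\<close>.
\<close>

lemma snd_affine_minorants_le_0_iff:
  assumes "convex_on (ball 0 1) h"
  shows "(\<forall>p\<in>affine_minorants h. snd p \<le> 0) \<longleftrightarrow> h 0 \<le> 0"
proof
  assume le: "\<forall>p\<in>affine_minorants h. snd p \<le> 0"
  obtain p where "p \<in> affine_minorants h" "p \<bullet> (0, 1) = h 0"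
    using ex_supporting_minorant[OF assms, of 0] by auto
  with le show "h 0 \<le> 0" by (auto simp: inner_prod_def)
next
  assume h0: "h 0 \<le> 0"
  show "\<forall>p\<in>affine_minorants h. snd p \<le> 0"
  proof
    fix p assume "p \<in> affine_minorants h"
    then have "p \<bullet> (0, 1) \<le> h 0"
      by (simp add: affine_minorants_def)
    then show "snd p \<le> 0" using h0 by (simp add: inner_prod_def)
  qed
qed

theorem theorem6p1:
  fixes f g h :: "real ^ 'n \<Rightarrow> real"
    and A B V :: "((real ^ 'n) \<times> real) set"
  assumes "convex_on (ball 0 1) g"
    and "convex_on (ball 0 1) h"
    and "\<forall>x\<in>ball 0 1. f x = g x - h x"
    and "A = {(x, t). \<forall>y. ereal (x \<bullet> y + t) \<le> ball_extension g y}"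
    and "B = {(x, t). \<forall>y. ereal (x \<bullet> y + t) \<le> ball_extension h y}"
    and "V = {(x, t). t \<le> - norm x}"
  shows "hartman_minimal f g h \<longleftrightarrow> H_minimal V (A, B)"
proof -
  note g = assms(1) and h = assms(2)
  have A: "A = affine_minorants g" and B: "B = affine_minorants h" and V: "V = down_cone"
    using assms(4-6) by (simp_all only: minorants_of_ball_extension down_cone_def)
  define adm where "adm = {(C, D) \<in> pair_class V (A, B). 0 \<in> D \<and> (\<forall>x\<in>D. snd x \<le> 0)}"
  define rep where "rep g1 h1 \<longleftrightarrow>
    dc_representation f g1 h1 \<and> (\<forall>x\<in>ball 0 1. 0 \<le> h1 x) \<and> h1 0 = 0" for g1 h1
  have adm_iff: "(affine_minorants g1, affine_minorants h1) \<in> adm \<longleftrightarrow> rep g1 h1"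
    if g1: "convex_on (ball 0 1) g1" and h1: "convex_on (ball 0 1) h1" for g1 h1
  proof -
    have "(\<forall>x\<in>ball 0 1. 0 \<le> h1 x) \<and> h1 0 \<le> 0 \<longleftrightarrow> (\<forall>x\<in>ball 0 1. 0 \<le> h1 x) \<and> h1 0 = 0"
      using centre_in_ball[of "0 :: real ^ 'n" 1] by (auto intro: order.antisym)
    moreover have "(\<forall>y\<in>ball 0 1. g1 y - h1 y = g y - h y) \<longleftrightarrow> dc_representation f g1 h1"
      using assms(3) g1 h1 by (auto simp: dc_representation_def)
    ultimately show ?thesis
      unfolding adm_def rep_def A B V
      by (simp add: affine_minorants_pair_class_iff[OF g h g1 h1] zero_mem_affine_minorants_iff
          snd_affine_minorants_le_0_iff[OF h1])
  qed
  have H: "H_minimal V (A, B) \<longleftrightarrow>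
      (A, B) \<in> adm \<and> (\<forall>C D. (C, D) \<in> adm \<longrightarrow> C \<subseteq> A \<longrightarrow> D \<subseteq> B \<longrightarrow> C = A \<and> D = B)"
    by (auto simp: H_minimal_def minimal_element_def pair_le_def adm_def)
  have hartman: "hartman_minimal f g h \<longleftrightarrow>
      rep g h \<and> (\<forall>g1 h1. rep g1 h1 \<longrightarrow> (\<forall>x\<in>ball 0 1. g1 x \<le> g x) \<longrightarrow> (\<forall>x\<in>ball 0 1. h1 x \<le> h x)
        \<longrightarrow> (\<forall>x\<in>ball 0 1. g1 x = g x) \<and> (\<forall>x\<in>ball 0 1. h1 x = h x))"
    unfolding hartman_minimal_def rep_def by blast
  \<comment> \<open>Every admissible pair of sets comes from a pair of functions, namely its support functions.\<close>
  have "(\<forall>C D. (C, D) \<in> adm \<longrightarrow> C \<subseteq> A \<longrightarrow> D \<subseteq> B \<longrightarrow> C = A \<and> D = B) \<longleftrightarrow>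
      (\<forall>g1 h1. rep g1 h1 \<longrightarrow> affine_minorants g1 \<subseteq> A \<longrightarrow> affine_minorants h1 \<subseteq> B
        \<longrightarrow> affine_minorants g1 = A \<and> affine_minorants h1 = B)"
    (is "?sets \<longleftrightarrow> ?funs")
  proof
    assume ?sets
    then show ?funs
      using adm_iff by (auto simp: rep_def dc_representation_def)
  next
    assume funs: ?funs
    show ?sets
    proof (intro allI impI)
      fix C D assume CD: "(C, D) \<in> adm" "C \<subseteq> A" "D \<subseteq> B"
      then have rec: "C \<in> closed_convex_rec down_cone" "D \<in> closed_convex_rec down_cone"
        by (auto simp: adm_def pair_class_def V)
      note eq = affine_minorants_support_fun[OF rec(1)] affine_minorants_support_fun[OF rec(2)]
      have "rep (support_fun C) (support_fun D)"
        using adm_iff[OF convex_on_support_fun[OF rec(1)] convex_on_support_fun[OF rec(2)]] CD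
        by (simp add: eq)
      then show "C = A \<and> D = B"
        using funs[rule_format, of "support_fun C" "support_fun D"] CD by (simp add: eq)
    qed
  qed
  also have "\<dots> \<longleftrightarrow>
      (\<forall>g1 h1. rep g1 h1 \<longrightarrow> (\<forall>x\<in>ball 0 1. g1 x \<le> g x) \<longrightarrow> (\<forall>x\<in>ball 0 1. h1 x \<le> h x)
        \<longrightarrow> (\<forall>x\<in>ball 0 1. g1 x = g x) \<and> (\<forall>x\<in>ball 0 1. h1 x = h x))"
  proof -
    have "affine_minorants g1 \<subseteq> A \<longleftrightarrow> (\<forall>x\<in>ball 0 1. g1 x \<le> g x)"
      "affine_minorants h1 \<subseteq> B \<longleftrightarrow> (\<forall>x\<in>ball 0 1. h1 x \<le> h x)"
      "affine_minorants g1 = A \<longleftrightarrow> (\<forall>x\<in>ball 0 1. g1 x = g x)"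
      "affine_minorants h1 = B \<longleftrightarrow> (\<forall>x\<in>ball 0 1. h1 x = h x)"
      if "rep g1 h1" for g1 h1
      using that unfolding A B rep_def dc_representation_def
      by (simp_all only: affine_minorants_subset_iff affine_minorants_eq_iff g h)
    then show ?thesis by (simp cong: imp_cong)
  qed
  finally show ?thesis
    unfolding H hartman using adm_iff[OF g h] by (simp add: A B)
qed

end
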